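(* Let $K$ be a $d$-dimensional simplicial complex, $\ell\ge 0$ an integer, and $f\in\mathcal{M}_\ell(K)$. Let $F$ be the set of non-critical $d$-cells of $f$ and $R$ the set of critical $(d-1)$-cells of $f$. Then $(F,R)$ is a rooted forest of $K$.
   Context: A simplicial complex $K$ is a finite family of finite sets closed under taking subsets; a $p$-cell is an element of size $p+1$, $K_p$ is the set of $p$-cells, and $K$ is $d$-dimensional if its maximal cells have dimension at most $d$ (and it has a $d$-cell); complexes are assumed connected. The incidence matrix $\partial_d$ has rows indexed by $K_{d-1}$ and columns by $K_d$, with entry $(-1)^j$ at $(r,f)$ if $f=\{v_0<\dots<v_d\}$ and $r=f\setminus\{v_j\}$, and $0$ otherwise. A subset $F\subseteq K_d$ is a forest if the corresponding columns of $\partial_d$ are linearly independent. For a forest $F$ and $R\subseteq K_{d-1}$ with $\bar R=K_{d-1}\setminus R$, $(F,R)$ is a rooted forest of $K$ if the rows indexed by $\bar R$ of the submatrix of $\partial_d$ with columns $F$ form a basis of its row space (equivalently, $|\bar R|=|F|$ and the square submatrix of $\partial_d$ with rows $\bar R$ and columns $F$ is nonsingular). A discrete Morse function is $f:K\to\mathbb{R}$ such that for each $p$-cell $\sigma$ there is at most one $(p-1)$-face $\tau<\sigma$ with $f(\tau)\ge f(\sigma)$ and at most one $(p+1)$-cell $\tau>\sigma$ with $f(\tau)\le f(\sigma)$; $\sigma$ is critical if there are none; $c_p(f)$ is the number of critical $p$-cells. The gradient is $V_f=\{(\sigma,\tau):\sigma \text{ a codimension-one face of }\tau,\ f(\tau)\le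 f(\sigma)\}$. $\mathcal{M}(K)$ is the set of discrete Morse functions modulo $f\sim g$ iff $V_f=V_g$ (critical cells depend only on the class), and $\mathcal{M}_\ell(K)=\{f\in\mathcal{M}(K): c_d(f)=\ell,\ c_p(f)=|K_p| \text{ for all } p<d-1\}$. *)

theory Defs
  imports Complex_Main "HOL-Library.Function_Algebras"
begin

definition fun_scale :: "real \<Rightarrow> ('i \<Rightarrow> real) \<Rightarrow> 'i \<Rightarrow> real" where
  "fun_scale a v = (\<lambda>i. a * v i)"

global_interpretation fun_space: vector_space fun_scale
  by unfold_locales (auto simp: fun_scale_def fun_eq_iff algebra_simps)

definition abstract_complex :: "'a set set \<Rightarrow> bool" where
  "abstract_complex K \<longleftrightarrow>
     finite K \<and> (\<forall>\<sigma>\<in>K. finite \<sigma>) \<and> (\<forall>\<sigma>\<in>K. \<forall>\<tau>. \<tau> \<subseteq> \<sigma> \<longrightarrow> \<tau> \<in> K)"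

text \<open>
  Closure under subsets puts the empty set into every nonempty \<open>K\<close>, but, as usual in discrete
  Morse theory, it is not a cell: cells have dimension at least 0. The dimension is an integer,
  so that \<open>cells K (-1) = {}\<close> and no truncated subtraction occurs.
\<close>

definition cells :: "'a set set \<Rightarrow> int \<Rightarrow> 'a set set" where
  "cells K p = {\<sigma>\<in>K. \<sigma> \<noteq> {} \<and> int (card \<sigma>) = p + 1}"

definition has_dimension :: "'a set set \<Rightarrow> nat \<Rightarrow> bool" where
  "has_dimension K d \<longleftrightarrow> (\<forall>\<sigma>\<in>K. card \<sigma> \<le> d + 1) \<and> cells K (int d) \<noteq> {}"

definition connected_complex :: "'a set set \<Rightarrow> bool" where
  "connected_complex K \<longleftrightarrow> (\<forall>u\<in>\<Union>K. \<forall>v\<in>\<Union>K. (u, v) \<in> {(x, y). {x, y} \<in> K}\<^sup>*)"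

text \<open>
  For \<open>f = {v\<^sub>0 < \<dots> < v\<^sub>d}\<close>, the vertex \<open>v\<^sub>j\<close> is \<open>sorted_list_of_set f ! j\<close>.
\<close>

definition boundary :: "'a::linorder set set \<Rightarrow> nat \<Rightarrow> 'a set \<Rightarrow> 'a set \<Rightarrow> real" where
  "boundary K d r f =
     (if r \<in> cells K (int d - 1) \<and> f \<in> cells K (int d) \<and>
         (\<exists>j\<le>d. r = f - {sorted_list_of_set f ! j})
      then (-1) ^ (THE j. j \<le> d \<and> r = f - {sorted_list_of_set f ! j})
      else 0)"

definition boundary_col :: "'a::linorder set set \<Rightarrow> nat \<Rightarrow> 'a set \<Rightarrow> 'a set \<Rightarrow> real" where
  "boundary_col K d f = (\<lambda>r. boundary K d r f)"

definition boundary_row ::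
    "'a::linorder set set \<Rightarrow> nat \<Rightarrow> 'a set set \<Rightarrow> 'a set \<Rightarrow> 'a set \<Rightarrow> real" where
  "boundary_row K d F r = (\<lambda>f. if f \<in> F then boundary K d r f else 0)"

text \<open>
  Columns and rows are treated as families; injectivity rules out repeated vectors, which the
  library's notion of independence, being one for sets, does not see.
\<close>

definition forest :: "'a::linorder set set \<Rightarrow> nat \<Rightarrow> 'a set set \<Rightarrow> bool" where
  "forest K d F \<longleftrightarrow>
     F \<subseteq> cells K (int d) \<and>
     inj_on (boundary_col K d) F \<and> fun_space.independent (boundary_col K d ` F)"

definition rooted_forest ::
    "'a::linorder set set \<Rightarrow> nat \<Rightarrow> 'a set set \<Rightarrow> 'a set set \<Rightarrow> bool" where
  "rooted_forest K d F R \<longleftrightarrow>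
     forest K d F \<and> R \<subseteq> cells K (int d - 1) \<and>
     (let Rbar = cells K (int d - 1) - R in
        inj_on (boundary_row K d F) Rbar \<and>
        fun_space.independent (boundary_row K d F ` Rbar) \<and>
        fun_space.span (boundary_row K d F ` Rbar) =
          fun_space.span (boundary_row K d F ` cells K (int d - 1)))"

text \<open>
  Functions on \<open>K\<close> are total functions; only their values on cells matter.
\<close>

definition lower_exceptions :: "'a set set \<Rightarrow> ('a set \<Rightarrow> real) \<Rightarrow> int \<Rightarrow> 'a set \<Rightarrow> 'a set set" where
  "lower_exceptions K f p \<sigma> = {\<tau> \<in> cells K (p - 1). \<tau> \<subset> \<sigma> \<and> f \<tau> \<ge> f \<sigma>}"

definition upper_exceptions :: "'a set set \<Rightarrow> ('a set \<Rightarrow> real) \<Rightarrow> int \<Rightarrow> 'a set \<Rightarrow> 'a set set" where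
  "upper_exceptions K f p \<sigma> = {\<tau> \<in> cells K (p + 1). \<sigma> \<subset> \<tau> \<and> f \<tau> \<le> f \<sigma>}"

definition discrete_morse :: "'a set set \<Rightarrow> ('a set \<Rightarrow> real) \<Rightarrow> bool" where
  "discrete_morse K f \<longleftrightarrow>
     (\<forall>p. \<forall>\<sigma>\<in>cells K p.
        card (lower_exceptions K f p \<sigma>) \<le> 1 \<and> card (upper_exceptions K f p \<sigma>) \<le> 1)"

definition critical_cells :: "'a set set \<Rightarrow> ('a set \<Rightarrow> real) \<Rightarrow> int \<Rightarrow> 'a set set" where
  "critical_cells K f p =
     {\<sigma> \<in> cells K p. lower_exceptions K f p \<sigma> = {} \<and> upper_exceptions K f p \<sigma> = {}}"

definition gradient :: "'a set set \<Rightarrow> ('a set \<Rightarrow> real) \<Rightarrow> ('a set \<times> 'a set) set" where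
  "gradient K f =
     {(\<sigma>, \<tau>). \<exists>p. \<sigma> \<in> cells K p \<and> \<tau> \<in> cells K (p + 1) \<and> \<sigma> \<subset> \<tau> \<and> f \<tau> \<le> f \<sigma>}"

definition morse_equiv :: "'a set set \<Rightarrow> (('a set \<Rightarrow> real) \<times> ('a set \<Rightarrow> real)) set" where
  "morse_equiv K =
     {(f, g). discrete_morse K f \<and> discrete_morse K g \<and> gradient K f = gradient K g}"

definition morse_classes :: "'a set set \<Rightarrow> ('a set \<Rightarrow> real) set set" where
  "morse_classes K = {f. discrete_morse K f} // morse_equiv K"

lemma equiv_morse_equiv: "equiv {f. discrete_morse K f} (morse_equiv K)"
  by (auto simp: equiv_def refl_on_def sym_def trans_def morse_equiv_def)

lemma critical_cells_gradient:
  "critical_cells K f p =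
     {\<sigma> \<in> cells K p. \<forall>\<tau>. (\<tau>, \<sigma>) \<notin> gradient K f \<and> (\<sigma>, \<tau>) \<notin> gradient K f}"
proof -
  have uniq: "p = q" if "\<sigma> \<in> cells K p" "\<sigma> \<in> cells K q" for \<sigma> p q
    using that by (simp add: cells_def)
  have low: "(\<tau>, \<sigma>) \<in> gradient K f \<longleftrightarrow> \<tau> \<in> lower_exceptions K f p \<sigma>"
    if "\<sigma> \<in> cells K p" for \<sigma> \<tau>
  proof
    assume "(\<tau>, \<sigma>) \<in> gradient K f"
    then obtain q where q: "\<tau> \<in> cells K q" "\<sigma> \<in> cells K (q + 1)" "\<tau> \<subset> \<sigma>" "f \<sigma> \<le> f \<tau>"
      by (auto simp: gradient_def)
    then have "q = p - 1" using uniq[OF that q(2)] by simp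
    then show "\<tau> \<in> lower_exceptions K f p \<sigma>" using q by (simp add: lower_exceptions_def)
  next
    assume "\<tau> \<in> lower_exceptions K f p \<sigma>"
    then show "(\<tau>, \<sigma>) \<in> gradient K f"
      using that by (auto simp: gradient_def lower_exceptions_def intro!: exI[of _ "p - 1"])
  qed
  have upp: "(\<sigma>, \<tau>) \<in> gradient K f \<longleftrightarrow> \<tau> \<in> upper_exceptions K f p \<sigma>"
    if "\<sigma> \<in> cells K p" for \<sigma> \<tau>
    using that uniq by (fastforce simp: gradient_def upper_exceptions_def)
  show ?thesis
    using low upp by (auto simp: critical_cells_def)
qed

lemma critical_cells_cong:
  "(f, g) \<in> morse_equiv K \<Longrightarrow> critical_cells K f p = critical_cells K g p"
  by (simp add: critical_cells_gradient morse_equiv_def)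

text \<open>
  By the preceding lemma it does not matter which representative of a class is inspected.
\<close>

definition morse_level :: "'a set set \<Rightarrow> nat \<Rightarrow> nat \<Rightarrow> ('a set \<Rightarrow> real) set set" where
  "morse_level K d l =
     {C \<in> morse_classes K. \<exists>f\<in>C.
        card (critical_cells K f (int d)) = l \<and>
        (\<forall>p < int d - 1. card (critical_cells K f p) = card (cells K p))}"

end

theory Submission
  imports Defs
begin

text \<open>
  Pairing each non-critical \<open>d\<close>-cell \<open>t\<close> with the unique facet \<open>m t\<close> satisfying
  \<open>f (m t) \<ge> f t\<close> gives a bijection from \<open>F\<close> onto the non-critical \<open>(d-1)\<close>-cells: these cannot
  be paired downwards, since all cells below dimension \<open>d - 1\<close> are critical. If \<open>m s\<close> is a facet
  of \<open>t \<noteq> s\<close>, then \<open>f s \<le> f (m s) < f t\<close>. Hence the square submatrix with rows \<open>m s\<close> and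
  columns \<open>t\<close> is triangular for the order given by \<open>f\<close>, with diagonal entries \<open>\<plusminus>1\<close>.
\<close>

section \<open>Independence and span of triangular families\<close>

lemma sum_apply: "(\<Sum>a\<in>A. v a) x = (\<Sum>a\<in>A. v a x)" for v :: "'b \<Rightarrow> 'i \<Rightarrow> real"
  by (induction A rule: infinite_finite_induct) auto

lemma independent_familyI:
  fixes v :: "'b \<Rightarrow> 'i \<Rightarrow> real"
  assumes fin: "finite A"
    and zero: "\<And>c a. (\<And>i. (\<Sum>a\<in>A. c a * v a i) = 0) \<Longrightarrow> a \<in> A \<Longrightarrow> c a = 0"
  shows "inj_on v A \<and> fun_space.independent (v ` A)"
proof
  show inj: "inj_on v A"
  proof (rule inj_onI, rule ccontr)
    fix a b assume ab: "a \<in> A" "b \<in> A" "v a = v b" "a \<noteq> b"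
    \<comment> \<open>A repeated vector \<open>v a = v b\<close> yields a vanishing combination with
      coefficients 1 and -1, so the hypothesis on scalars also forces injectivity.\<close>
    define c :: "'b \<Rightarrow> real" where "c = (\<lambda>x. (if x = a then 1 else 0) - (if x = b then 1 else 0))"
    have "(\<Sum>x\<in>A. c x * v x i) = 0" for i
    proof -
      have "(\<Sum>x\<in>A. c x * v x i) =
          (\<Sum>x\<in>A. if x = a then v x i else 0) - (\<Sum>x\<in>A. if x = b then v x i else 0)"
        unfolding sum_subtractf[symmetric] by (rule sum.cong) (auto simp: c_def)
      also have "\<dots> = 0" using ab fin by simp
      finally show ?thesis .
    qed
    then have "c a = 0" using zero ab by blast
    then show False using ab by (simp add: c_def)
  qed
  show "fun_space.independent (v ` A)"
  proof (rule fun_space.independent_if_scalars_zero)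
    show "finite (v ` A)" using fin by simp
    fix u x
    assume sum0: "(\<Sum>x\<in>v ` A. fun_scale (u x) x) = 0" and x: "x \<in> v ` A"
    then obtain a where a: "a \<in> A" "x = v a" by blast
    have "(\<Sum>a\<in>A. u (v a) * v a i) = 0" for i
      using fun_cong[OF sum0, of i] inj
      by (simp add: sum.reindex sum_apply fun_scale_def)
    then have "(u \<circ> v) a = 0" using zero[of "u \<circ> v"] a by simp
    then show "u x = 0" using a by simp
  qed
qed

text \<open>In a vanishing combination, let \<open>t\<close> have minimal \<open>g\<close> among the
  indices with nonzero coefficient. At coordinate \<open>p t\<close> any other such contribution
  would come from an index with smaller \<open>g\<close>, so only the nonzero diagonal term is
  left.\<close>

lemma triangular_family_independent:
  fixes v :: "'b \<Rightarrow> 'i \<Rightarrow> real" and g :: "'b \<Rightarrow> real"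
  assumes fin: "finite A"
    and diag: "\<And>a. a \<in> A \<Longrightarrow> v a (p a) \<noteq> 0"
    and tri: "\<And>a b. a \<in> A \<Longrightarrow> b \<in> A \<Longrightarrow> a \<noteq> b \<Longrightarrow> v a (p b) \<noteq> 0 \<Longrightarrow> g a < g b"
  shows "inj_on v A \<and> fun_space.independent (v ` A)"
proof (rule independent_familyI[OF fin])
  fix c a
  assume sum0: "\<And>i. (\<Sum>a\<in>A. c a * v a i) = 0" and a: "a \<in> A"
  show "c a = 0"
  proof (rule ccontr)
    assume "c a \<noteq> 0"
    let ?S = "{x \<in> A. c x \<noteq> 0}"
    have "finite ?S" "?S \<noteq> {}" using fin a \<open>c a \<noteq> 0\<close> by auto
    then obtain t where t: "t \<in> ?S" "\<And>x. x \<in> ?S \<Longrightarrow> g t \<le> g x"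
      using ex_min_if_finite[of "g ` ?S"] by (metis (no_types, lifting) arg_min_least arg_min_if_finite(1))
    have "c x * v x (p t) = 0" if "x \<in> A" "x \<noteq> t" for x
      using t that tri[of x t] by (metis (mono_tags, lifting) linorder_not_less mem_Collect_eq mult_eq_0_iff)
    then have "(\<Sum>x\<in>A. c x * v x (p t)) = (\<Sum>x\<in>{t}. c x * v x (p t))"
      using fin t(1) by (intro sum.mono_neutral_right) auto
    then show False using sum0[of "p t"] t diag[of t] by simp
  qed
qed

lemma triangular_family_spans:
  fixes v :: "'b \<Rightarrow> 'i \<Rightarrow> real" and g :: "'b \<Rightarrow> real"
  assumes fin: "finite A"
    and diag: "\<And>a. a \<in> A \<Longrightarrow> v a (p a) \<noteq> 0"
    and tri: "\<And>a b. a \<in> A \<Longrightarrow> b \<in> A \<Longrightarrow> a \<noteq> b \<Longrightarrow> v a (p b) \<noteq> 0 \<Longrightarrow> g a < g b"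
    and supp: "\<And>a i. a \<in> A \<Longrightarrow> i \<notin> p ` A \<Longrightarrow> v a i = 0"
    and w: "\<And>i. i \<notin> p ` A \<Longrightarrow> w i = 0"
    and inj: "inj_on p A"
  shows "w \<in> fun_space.span (v ` A)"
proof -
  define e :: "'b \<Rightarrow> 'i \<Rightarrow> real" where "e b = (\<lambda>i. if i = p b then 1 else 0)" for b
  have expand: "x = (\<Sum>b\<in>A. fun_scale (x (p b)) (e b))"
    if "\<And>i. i \<notin> p ` A \<Longrightarrow> x i = 0" for x
  proof
    fix i
    have "(\<Sum>b\<in>A. x (p b) * e b i) = x i"
    proof (cases "i \<in> p ` A")
      case True
      then obtain a where a: "a \<in> A" "i = p a" by blast
      then have "(\<Sum>b\<in>A. x (p b) * e b i) = (\<Sum>b\<in>A. if b = a then x i else 0)"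
        using inj by (intro sum.cong) (auto simp: e_def inj_on_def)
      then show ?thesis using a fin by simp
    next
      case False
      then show ?thesis using that by (auto simp: e_def intro!: sum.neutral)
    qed
    then show "x i = (\<Sum>b\<in>A. fun_scale (x (p b)) (e b)) i"
      by (simp add: sum_apply fun_scale_def)
  qed
  have unit: "e a \<in> fun_space.span (v ` A)" if "a \<in> A" for a
    using that
  \<comment> \<open>Since \<open>A\<close> is finite, counting the indices with strictly larger
    \<open>g\<close> turns descent along real values into a well-founded induction.\<close>
  proof (induction "card {b \<in> A. g a < g b}" arbitrary: a rule: less_induct)
    case less
    let ?S = "\<Sum>b\<in>A - {a}. fun_scale (v a (p b)) (e b)"
    have "fun_scale (v a (p b)) (e b) \<in> fun_space.span (v ` A)" if b: "b \<in> A - {a}" for b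
    proof (cases "v a (p b) = 0")
      case True
      then show ?thesis by (simp add: fun_space.span_zero)
    next
      case False
      then have "g a < g b" using tri less.prems b by blast
      then have "{c \<in> A. g b < g c} \<subset> {c \<in> A. g a < g c}" using b by auto
      then have "card {c \<in> A. g b < g c} < card {c \<in> A. g a < g c}"
        using fin by (intro psubset_card_mono) auto
      then show ?thesis using less.hyps b by (simp add: fun_space.span_scale)
    qed
    then have S: "?S \<in> fun_space.span (v ` A)" by (rule fun_space.span_sum)
    have "v a = fun_scale (v a (p a)) (e a) + ?S"
      using expand[of "v a"] supp less.prems fin by (simp add: sum.remove[of A a])
    then have "fun_scale (v a (p a)) (e a) = v a - ?S"
      by (simp add: algebra_simps)
    also have "\<dots> \<in> fun_space.span (v ` A)"
      using S less.prems by (intro fun_space.span_diff) (auto intro: fun_space.span_base)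
    finally have "fun_scale (inverse (v a (p a))) (fun_scale (v a (p a)) (e a))
        \<in> fun_space.span (v ` A)"
      by (rule fun_space.span_scale)
    then show ?case using diag less.prems by simp
  qed
  have "(\<Sum>b\<in>A. fun_scale (w (p b)) (e b)) \<in> fun_space.span (v ` A)"
    by (intro fun_space.span_sum fun_space.span_scale unit)
  then show ?thesis using expand[OF w] by simp
qed

section \<open>From the incidence matrix to rooted forests\<close>

lemma boundary_neq_0_iff:
  assumes K: "abstract_complex K"
    and r: "r \<in> cells K (int d - 1)" and t: "t \<in> cells K (int d)"
  shows "boundary K d r t \<noteq> 0 \<longleftrightarrow> r \<subset> t"
proof -
  have fin: "finite t" using K t by (auto simp: abstract_complex_def cells_def)
  have card: "card t = d + 1" "card r = d" using r t by (auto simp: cells_def)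
  \<comment> \<open>A nonzero entry is a power of -1, so only the existence of a deleted vertex
    matters, not its position.\<close>
  have "(\<exists>j\<le>d. r = t - {sorted_list_of_set t ! j}) \<longleftrightarrow> r \<subset> t"
  proof
    assume "\<exists>j\<le>d. r = t - {sorted_list_of_set t ! j}"
    then have "r \<subseteq> t" by blast
    moreover have "r \<noteq> t" using card by fastforce
    ultimately show "r \<subset> t" by blast
  next
    assume sub: "r \<subset> t"
    have "card (t - r) = 1"
      using sub card fin by (subst card_Diff_subset) (auto intro: finite_subset)
    then obtain x where x: "t - r = {x}" by (auto simp: card_1_singleton_iff)
    then have "x \<in> set (sorted_list_of_set t)" using fin by auto
    then obtain j where "j < card t" "x = sorted_list_of_set t ! j"
      by (auto simp: in_set_conv_nth)
    moreover have "r = t - {x}" using x sub by blast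
    ultimately show "\<exists>j\<le>d. r = t - {sorted_list_of_set t ! j}"
      using card(1) by (metis Suc_eq_plus1 less_Suc_eq_le)
  qed
  then show ?thesis using r t by (simp add: boundary_def)
qed

lemma rooted_forest_of_gradient:
  fixes K :: "'a::linorder set set"
  assumes K: "abstract_complex K"
    and F: "F \<subseteq> cells K (int d)" and R: "R \<subseteq> cells K (int d - 1)"
    and m: "bij_betw m F (cells K (int d - 1) - R)"
    and face: "\<And>t. t \<in> F \<Longrightarrow> m t \<subset> t"
    and tri: "\<And>s t. s \<in> F \<Longrightarrow> t \<in> F \<Longrightarrow> s \<noteq> t \<Longrightarrow> m s \<subset> t \<Longrightarrow> (f s :: real) < f t"
  shows "rooted_forest K d F R"
proof -
  let ?C = "cells K (int d - 1)"
  let ?row = "boundary_row K d F"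
  have finF: "finite F"
    using K F by (auto simp: abstract_complex_def cells_def intro: finite_subset)
  have mF: "m t \<in> ?C" if "t \<in> F" for t
    using m that by (auto simp: bij_betw_def)
  have nz: "boundary K d (m s) t \<noteq> 0 \<longleftrightarrow> m s \<subset> t" if "s \<in> F" "t \<in> F" for s t
    using boundary_neq_0_iff[OF K mF] F that by blast
  \<comment> \<open>Column \<open>t\<close> is tested at row \<open>m s\<close>. A nonzero
    off-diagonal entry gives \<open>f s < f t\<close>, so columns are triangular for the reversed
    order, hence \<open>- f\<close>; the rows below use \<open>f\<close> itself.\<close>
  have col: "inj_on (boundary_col K d) F \<and> fun_space.independent (boundary_col K d ` F)"
    using nz face tri
    by (intro triangular_family_independent[OF finF, where p = m and g = "\<lambda>t. - f t"])
      (auto simp: boundary_col_def)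
  have row: "inj_on (?row \<circ> m) F \<and> fun_space.independent ((?row \<circ> m) ` F)"
    using nz face tri
    by (intro triangular_family_independent[OF finF, where p = id and g = f])
      (auto simp: boundary_row_def)
  have img: "(?row \<circ> m) ` F = ?row ` (?C - R)"
    using m by (metis bij_betw_def image_comp)
  have inj: "inj_on ?row (?C - R)"
    using row m by (metis bij_betw_def comp_inj_on_iff)
  \<comment> \<open>Restricted rows vanish outside \<open>F\<close>, and the rows \<open>m s\<close>
    span all vectors supported there; hence rows of cells in \<open>R\<close> lie in the span
    too.\<close>
  have "?row r \<in> fun_space.span ((?row \<circ> m) ` F)" for r
    using nz face tri
    by (intro triangular_family_spans[OF finF, where p = id and g = f])
      (auto simp: boundary_row_def)
  then have "?row ` ?C \<subseteq> fun_space.span (?row ` (?C - R))"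
    unfolding img by blast
  then have "fun_space.span (?row ` (?C - R)) = fun_space.span (?row ` ?C)"
    by (intro antisym fun_space.span_minimal fun_space.span_mono image_mono
        fun_space.subspace_span) auto
  then show ?thesis
    using col row inj F R unfolding rooted_forest_def forest_def img Let_def by blast
qed

section \<open>Critical cells and gradient pairs\<close>

lemma finite_cells: "abstract_complex K \<Longrightarrow> finite (cells K p)"
  by (simp add: abstract_complex_def cells_def)

lemma cells_above_dimension:
  assumes "has_dimension K d" and "p > int d"
  shows "cells K p = {}"
  using assms by (force simp: has_dimension_def cells_def)

text \<open>The level condition is known only for some \<open>g\<close> in the class; equal
  gradients carry it over to \<open>f\<close>. Equal finite cardinalities then make every cell in
  these dimensions critical.\<close>

lemma morse_level_representative:
  assumes K: "abstract_complex K" and C: "C \<in> morse_level K d l" and f: "f \<in> C"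
  shows "discrete_morse K f"
    and "p < int d - 1 \<Longrightarrow> critical_cells K f p = cells K p"
proof -
  obtain g where g: "g \<in> C" "\<And>p. p < int d - 1 \<Longrightarrow> card (critical_cells K g p) = card (cells K p)"
    and Cq: "C \<in> {f. discrete_morse K f} // morse_equiv K"
    using C by (auto simp: morse_level_def morse_classes_def)
  have fg: "(f, g) \<in> morse_equiv K"
    using quotient_eq_iff[OF equiv_morse_equiv Cq Cq f g(1)] by simp
  then show "discrete_morse K f" by (simp add: morse_equiv_def)
  assume p: "p < int d - 1"
  show "critical_cells K f p = cells K p"
    unfolding critical_cells_cong[OF fg]
    by (rule card_subset_eq[OF finite_cells[OF K] _ g(2)[OF p]]) (auto simp: critical_cells_def)
qed

text \<open>The gradient pairs between dimensions \<open>p - 1\<close> and \<open>p\<close> form a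
  matching: the bound on upper exceptions applies at a shared face, the bound on lower exceptions at
  a shared coface.\<close>

lemma discrete_morse_unique:
  assumes K: "abstract_complex K" and f: "discrete_morse K f"
    and "r \<in> cells K (p - 1)" "r \<subset> t" "f t \<le> f r" "t \<in> cells K p"
    and "s \<in> cells K (p - 1)" "s \<subset> u" "f u \<le> f s" "u \<in> cells K p"
  shows "r = s \<longleftrightarrow> t = u"
proof
  assume "r = s"
  have "finite (upper_exceptions K f (p - 1) r)"
    using finite_cells[OF K] by (simp add: upper_exceptions_def)
  moreover have "card (upper_exceptions K f (p - 1) r) \<le> 1"
    using f assms(3) by (simp add: discrete_morse_def)
  moreover have "t \<in> upper_exceptions K f (p - 1) r" "u \<in> upper_exceptions K f (p - 1) r"
    using assms(3-) \<open>r = s\<close> by (simp_all add: upper_exceptions_def)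
  ultimately show "t = u" by (simp add: card_le_Suc0_iff_eq)
next
  assume "t = u"
  have "finite (lower_exceptions K f p t)"
    using finite_cells[OF K] by (simp add: lower_exceptions_def)
  moreover have "card (lower_exceptions K f p t) \<le> 1"
    using f assms(6) by (simp add: discrete_morse_def)
  moreover have "r \<in> lower_exceptions K f p t" "s \<in> lower_exceptions K f p t"
    using assms(3-) \<open>t = u\<close> by (simp_all add: lower_exceptions_def)
  ultimately show "r = s" by (simp add: card_le_Suc0_iff_eq)
qed

theorem theorem4p1:
  fixes K :: "'a::linorder set set" and d l :: nat
    and C :: "('a set \<Rightarrow> real) set" and f :: "'a set \<Rightarrow> real"
  assumes "abstract_complex K" and "connected_complex K" and "has_dimension K d"
    and "C \<in> morse_level K d l" and "f \<in> C"
  shows "rooted_forest K d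
           (cells K (int d) - critical_cells K f (int d))
           (critical_cells K f (int d - 1))"
proof -
  let ?C = "cells K (int d - 1)"
  let ?F = "cells K (int d) - critical_cells K f (int d)"
  let ?R = "critical_cells K f (int d - 1)"
  note K = assms(1)
  note morse = morse_level_representative[OF K assms(4,5)]
  note uniq = discrete_morse_unique[OF K morse(1), where p = "int d"]
  \<comment> \<open>There are no cells of dimension \<open>d + 1\<close>, so a non-critical
    \<open>d\<close>-cell must have a lower exception.\<close>
  have "\<exists>r. r \<in> ?C \<and> r \<subset> t \<and> f t \<le> f r" if "t \<in> ?F" for t
    using that cells_above_dimension[OF assms(3), of "int d + 1"]
    by (auto simp: critical_cells_def lower_exceptions_def upper_exceptions_def)
  then obtain m where m: "\<And>t. t \<in> ?F \<Longrightarrow> m t \<in> ?C \<and> m t \<subset> t \<and> f t \<le> f (m t)"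
    by metis
  have "m t \<notin> ?R" if "t \<in> ?F" for t
  proof -
    have "t \<in> upper_exceptions K f (int d - 1) (m t)"
      using m[OF that] that by (simp add: upper_exceptions_def)
    then show ?thesis unfolding critical_cells_def by blast
  qed
  moreover have "\<exists>t\<in>?F. m t = r" if r: "r \<in> ?C - ?R" for r
  proof -
    \<comment> \<open>A lower exception \<open>q\<close> of \<open>r\<close> would have
      \<open>r\<close> as an upper exception, although all cells of dimension \<open>d - 2\<close>
      are critical.\<close>
    have "lower_exceptions K f (int d - 1) r = {}"
    proof (rule ccontr)
      assume "lower_exceptions K f (int d - 1) r \<noteq> {}"
      then obtain q where q: "q \<in> cells K (int d - 2)" "q \<subset> r" "f r \<le> f q"
        by (auto simp: lower_exceptions_def)
      then have "q \<in> critical_cells K f (int d - 2)" using morse(2)[of "int d - 2"] by simp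
      then show False using q r by (auto simp: critical_cells_def upper_exceptions_def)
    qed
    then obtain t where t: "t \<in> cells K (int d)" "r \<subset> t" "f t \<le> f r"
      using r by (auto simp: critical_cells_def upper_exceptions_def)
    then have "t \<in> ?F" using r by (auto simp: critical_cells_def lower_exceptions_def)
    then show ?thesis using uniq[of "m t" t r t] m[of t] t r by blast
  qed
  moreover have "inj_on m ?F"
  proof (rule inj_onI)
    fix s t assume "s \<in> ?F" "t \<in> ?F" "m s = m t"
    then show "s = t" using uniq[of "m s" s "m t" t] m by blast
  qed
  ultimately have bij: "bij_betw m ?F (?C - ?R)"
    using m unfolding bij_betw_def by blast
  show ?thesis
  proof (rule rooted_forest_of_gradient[OF K _ _ bij, where f = f])
    show "?R \<subseteq> ?C" by (auto simp: critical_cells_def)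
    fix s t assume st: "s \<in> ?F" "t \<in> ?F" "s \<noteq> t" "m s \<subset> t"
    \<comment> \<open>Otherwise \<open>m s\<close> would be paired with both \<open>s\<close> and
      \<open>t\<close>.\<close>
    have "f (m s) < f t"
    proof (rule ccontr)
      assume "\<not> f (m s) < f t"
      then have "f t \<le> f (m s)" by simp
      then have "s = t" using uniq[of "m s" t "m s" s] m[of s] st by blast
      then show False using st by simp
    qed
    then show "f s < f t" using m st by fastforce
  qed (use m in auto)
qed

end
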